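(* Let $A$ be a finite set, let $X \subset A^{\mathbb{Z}}$ be a subshift of finite type, and let $x \in X$. Denote by $\mathcal{C}$ the poset of irreducible components of $X$. Then the following conditions are equivalent: (a) the configuration $x$ is isolated in $X$ (i.e., $\{x\}$ is open in $X$); (b) the irreducible components $C_\alpha(x)$ and $C_\omega(x)$ are both finite, with $C_\alpha(x)$ minimal and $C_\omega(x)$ maximal in $\mathcal{C}$.
   Context: $A^{\mathbb{Z}}$ carries the product topology ($A$ discrete) and the shift homeomorphism $\sigma$, $(\sigma(x))_i = x_{i+1}$. A subshift is a closed subset $X\subset A^{\mathbb{Z}}$ with $\sigma(X)=X$. It is of finite type if there are an integer $n\ge 0$ and $S\subset A^n$ such that $X$ is the set of all $x\in A^{\mathbb{Z}}$ with $(x_{i+1},\dots,x_{i+n})\in S$ for all $i\in\mathbb{Z}$. $\mathrm{NW}(X)$ is the set of $x\in X$ such that for every neighborhood $U$ of $x$ in $X$ there is $n\ge1$ with $U\cap\sigma^n(U)\neq\varnothing$. A subshift $Y$ is irreducible if it is non-empty and for all non-empty open $U,W\subset Y$ there is $n\ge 1$ with $U\cap\sigma^n(W)\ne\varnothing$. For a subshift of finite type $X$, there is a unique finite partition $\mathcal{C}$ of $\mathrm{NW}(X)$ into irreducible subshifts; its elements are the irreducible components of $X$. For $x\in X$, $\alpha(x)$ (resp. $\omega(x)$) is the set of limits of convergent sequences $(\sigma^{-n_k}(x))_k$ (resp. $(\sigma^{n_k}(x))_k$) with $(n_k)$ a strictly increasing sequence of non-negative integers; there are unique $C_\alpha(x),C_\omega(x)\in\mathcal{C}$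 with $\alpha(x)\subset C_\alpha(x)$, $\omega(x)\subset C_\omega(x)$. $\mathcal{C}$ is partially ordered by: $C\preceq C'$ iff there is $x\in X$ with $C_\alpha(x)=C$ and $C_\omega(x)=C'$. *)

theory Defs
  imports "HOL-Analysis.Analysis"
begin

definition full_shift :: "'a set \<Rightarrow> (int \<Rightarrow> 'a) topology" where
  "full_shift A = product_topology (\<lambda>_. discrete_topology A) UNIV"

definition shift_map :: "(int \<Rightarrow> 'a) \<Rightarrow> (int \<Rightarrow> 'a)" where
  "shift_map x = (\<lambda>i. x (i + 1))"

lemma bij_shift_map: "bij shift_map"
proof (rule bij_betw_byWitness[where f' = "\<lambda>x i. x (i - 1)"])
qed (auto simp: shift_map_def)

lemma inv_shift_map: "inv shift_map x = (\<lambda>i. x (i - 1))"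
  by (rule inv_f_eq) (auto simp: shift_map_def bij_shift_map bij_is_inj)

definition subshift :: "'a set \<Rightarrow> (int \<Rightarrow> 'a) set \<Rightarrow> bool" where
  "subshift A X \<longleftrightarrow> closedin (full_shift A) X \<and> shift_map ` X = X"

text \<open>The set $A^n$ is represented by the lists of length $n$ over $A$.\<close>

definition subshift_of_finite_type :: "'a set \<Rightarrow> (int \<Rightarrow> 'a) set \<Rightarrow> bool" where
  "subshift_of_finite_type A X \<longleftrightarrow> subshift A X \<and>
     (\<exists>n. \<exists>S \<subseteq> {w. length w = n \<and> set w \<subseteq> A}.
        X = {x \<in> topspace (full_shift A). \<forall>i. map (\<lambda>k. x (i + int k)) [1..<n + 1] \<in> S})"

definition nonwandering :: "'a set \<Rightarrow> (int \<Rightarrow> 'a) set \<Rightarrow> (int \<Rightarrow> 'a) set" where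
  "nonwandering A X =
     {x \<in> X. \<forall>U \<subseteq> X. (\<exists>V. openin (subtopology (full_shift A) X) V \<and> x \<in> V \<and> V \<subseteq> U)
        \<longrightarrow> (\<exists>n\<ge>1. U \<inter> (shift_map ^^ n) ` U \<noteq> {})}"

definition irreducible_subshift :: "'a set \<Rightarrow> (int \<Rightarrow> 'a) set \<Rightarrow> bool" where
  "irreducible_subshift A Y \<longleftrightarrow> subshift A Y \<and> Y \<noteq> {} \<and>
     (\<forall>U W. openin (subtopology (full_shift A) Y) U \<and> U \<noteq> {} \<and>
            openin (subtopology (full_shift A) Y) W \<and> W \<noteq> {}
        \<longrightarrow> (\<exists>n\<ge>1. U \<inter> (shift_map ^^ n) ` W \<noteq> {}))"

text \<open>The definite descriptions below denote what is intended when \<open>A\<close> is finite, \<open>X\<close> is a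
  subshift of finite type over \<open>A\<close> and \<open>x \<in> X\<close>; in that case the described objects exist and are
  unique.\<close>

definition irreducible_components :: "'a set \<Rightarrow> (int \<Rightarrow> 'a) set \<Rightarrow> (int \<Rightarrow> 'a) set set" where
  "irreducible_components A X =
     (THE P. finite P \<and> partition_on (nonwandering A X) P \<and> (\<forall>Y\<in>P. irreducible_subshift A Y))"

definition alpha_limit :: "'a set \<Rightarrow> (int \<Rightarrow> 'a) \<Rightarrow> (int \<Rightarrow> 'a) set" where
  "alpha_limit A x = {y. \<exists>n :: nat \<Rightarrow> nat. strict_mono n \<and>
     limitin (full_shift A) (\<lambda>k. (inv shift_map ^^ n k) x) y sequentially}"

definition omega_limit :: "'a set \<Rightarrow> (int \<Rightarrow> 'a) \<Rightarrow> (int \<Rightarrow> 'a) set" where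
  "omega_limit A x = {y. \<exists>n :: nat \<Rightarrow> nat. strict_mono n \<and>
     limitin (full_shift A) (\<lambda>k. (shift_map ^^ n k) x) y sequentially}"

definition C_alpha :: "'a set \<Rightarrow> (int \<Rightarrow> 'a) set \<Rightarrow> (int \<Rightarrow> 'a) \<Rightarrow> (int \<Rightarrow> 'a) set" where
  "C_alpha A X x = (THE C. C \<in> irreducible_components A X \<and> alpha_limit A x \<subseteq> C)"

definition C_omega :: "'a set \<Rightarrow> (int \<Rightarrow> 'a) set \<Rightarrow> (int \<Rightarrow> 'a) \<Rightarrow> (int \<Rightarrow> 'a) set" where
  "C_omega A X x = (THE C. C \<in> irreducible_components A X \<and> omega_limit A x \<subseteq> C)"

definition component_le ::
    "'a set \<Rightarrow> (int \<Rightarrow> 'a) set \<Rightarrow> (int \<Rightarrow> 'a) set \<Rightarrow> (int \<Rightarrow> 'a) set \<Rightarrow> bool" where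
  "component_le A X C C' \<longleftrightarrow> (\<exists>x\<in>X. C_alpha A X x = C \<and> C_omega A X x = C')"

definition minimal_component :: "'a set \<Rightarrow> (int \<Rightarrow> 'a) set \<Rightarrow> (int \<Rightarrow> 'a) set \<Rightarrow> bool" where
  "minimal_component A X C \<longleftrightarrow> C \<in> irreducible_components A X \<and>
     (\<forall>D \<in> irreducible_components A X. component_le A X D C \<longrightarrow> D = C)"

definition maximal_component :: "'a set \<Rightarrow> (int \<Rightarrow> 'a) set \<Rightarrow> (int \<Rightarrow> 'a) set \<Rightarrow> bool" where
  "maximal_component A X C \<longleftrightarrow> C \<in> irreducible_components A X \<and>
     (\<forall>D \<in> irreducible_components A X. component_le A X C D \<longrightarrow> D = C)"

end

theory Submission
  imports Defs
begin

text \<open>A subshift of finite type consists of all configurations whose blocks of some fixed length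
  \<open>N\<close> occur in it, so two of its configurations can be spliced along a common block. Blocks are
  preordered by occurring one after the other in a configuration; the irreducible components
  correspond to the equivalence classes \<open>K\<close> of recurrent blocks, and \<open>C\<^sub>\<alpha>(x)\<close>, \<open>C\<^sub>\<omega>(x)\<close> to the
  classes containing all blocks of \<open>x\<close> far to the left and far to the right.

  If \<open>x\<close> is isolated, splicing shows that a block far to the left in \<open>x\<close> determines its past. Every
  configuration of \<open>C\<^sub>\<alpha>(x)\<close>, and every configuration leading into \<open>C\<^sub>\<alpha>(x)\<close>, can be
  continued to that block, so \<open>C\<^sub>\<alpha>(x)\<close> consists of configurations of one common period and is
  minimal. Conversely, minimality keeps the past of any configuration close to \<open>x\<close> in the
  class of \<open>C\<^sub>\<alpha>(x)\<close>, and finiteness (hence periodicity of the elements of \<open>C\<^sub>\<alpha>(x)\<close>) leaves only one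
  such past. The future is handled in the same way.\<close>

section \<open>Topology of the full shift in terms of finite windows\<close>

lemma topspace_full_shift: "topspace (full_shift A) = {x. \<forall>i. x i \<in> A}"
  by (auto simp: full_shift_def PiE_def Pi_def)

lemma shift_map_funpow: "(shift_map ^^ n) x = (\<lambda>i. x (i + int n))"
  by (induction n) (auto simp: shift_map_def algebra_simps)

lemma inv_shift_map_funpow: "(inv shift_map ^^ n) x = (\<lambda>i. x (i - int n))"
  by (induction n) (auto simp: inv_shift_map algebra_simps)

lemma openin_cylinder:
  assumes "Y \<subseteq> topspace (full_shift A)"
  shows "openin (subtopology (full_shift A) Y) {y \<in> Y. \<forall>k. \<bar>k\<bar> \<le> m \<longrightarrow> y k = x k}"
proof -
  have coord: "openin (full_shift A) {y \<in> topspace (full_shift A). y k = x k}" for k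
  proof -
    have "continuous_map (full_shift A) (discrete_topology A) (\<lambda>y. y k)"
      unfolding full_shift_def by (rule continuous_map_product_projection) simp
    from openin_continuous_map_preimage[OF this, of "A \<inter> {x k}"]
    have "openin (full_shift A) {y \<in> topspace (full_shift A). y k \<in> A \<inter> {x k}}"
      by simp
    moreover have "{y \<in> topspace (full_shift A). y k \<in> A \<inter> {x k}}
        = {y \<in> topspace (full_shift A). y k = x k}"
      unfolding topspace_full_shift by blast
    ultimately show ?thesis by simp
  qed
  have "openin (full_shift A)
      (topspace (full_shift A) \<inter> (\<Inter>k\<in>{-m..m}. {y \<in> topspace (full_shift A). y k = x k}))"
  \<comment> \<open>A negative \<open>m\<close> makes the index set empty and the intersection
    \<open>UNIV\<close>; openness then comes from the factor
    \<open>topspace (full_shift A)\<close>.\<close>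
  proof (cases "{-m..m} = {}")
    case True
    then show ?thesis by (metis Inf_empty Int_UNIV_right image_empty openin_topspace)
  next
    case False
    then show ?thesis using coord by (intro openin_Int openin_topspace openin_INT) auto
  qed
  moreover have "{y \<in> Y. \<forall>k. \<bar>k\<bar> \<le> m \<longrightarrow> y k = x k} =
      (topspace (full_shift A) \<inter> (\<Inter>k\<in>{-m..m}. {y \<in> topspace (full_shift A). y k = x k})) \<inter> Y"
    using assms by (auto simp: abs_le_iff)
  ultimately show ?thesis
    unfolding openin_subtopology by blast
qed

text \<open>A basic open set of the product constrains finitely many coordinates, all inside one
  window around 0; conversely, cylinders are open.\<close>

lemma openin_subtopology_full_shift_iff:
  assumes "Y \<subseteq> topspace (full_shift A)"
  shows "openin (subtopology (full_shift A) Y) U \<longleftrightarrow>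
    U \<subseteq> Y \<and> (\<forall>x\<in>U. \<exists>m. \<forall>y\<in>Y. (\<forall>k. \<bar>k\<bar> \<le> m \<longrightarrow> y k = x k) \<longrightarrow> y \<in> U)"
    (is "?L \<longleftrightarrow> ?R")
proof
  assume ?L
  then obtain T where T: "openin (full_shift A) T" "U = T \<inter> Y"
    by (auto simp: openin_subtopology)
  have "\<exists>m. \<forall>y\<in>Y. (\<forall>k. \<bar>k\<bar> \<le> m \<longrightarrow> y k = x k) \<longrightarrow> y \<in> U" if x: "x \<in> U" for x
  proof -
    obtain W where W: "finite {i. W i \<noteq> topspace (discrete_topology A)}"
        "x \<in> Pi\<^sub>E UNIV W" "Pi\<^sub>E UNIV W \<subseteq> T"
      using T x unfolding full_shift_def openin_product_topology_alt by fastforce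
    obtain m where m: "\<And>k. W k \<noteq> A \<Longrightarrow> \<bar>k\<bar> \<le> m"
      using W(1) bdd_above_finite[of "abs ` {i. W i \<noteq> A}"] by (auto simp: bdd_above_def)
    have "y \<in> U" if y: "y \<in> Y" "\<forall>k. \<bar>k\<bar> \<le> m \<longrightarrow> y k = x k" for y
    proof -
      have "y k \<in> W k" for k
      proof (cases "W k = A")
        case True
        then show ?thesis using y(1) assms by (auto simp: topspace_full_shift)
      next
        case False
        then show ?thesis using m y(2) W(2) by (auto simp: PiE_def Pi_def)
      qed
      then have "y \<in> T" using W(3) by (auto simp: PiE_def)
      then show ?thesis using T y by blast
    qed
    then show ?thesis by blast
  qed
  then show ?R using T by blast
next
  assume R: ?R
  show ?L
  proof (subst openin_subopen, intro ballI)
    fix x assume x: "x \<in> U"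
    with R obtain m where m: "\<forall>y\<in>Y. (\<forall>k. \<bar>k\<bar> \<le> m \<longrightarrow> y k = x k) \<longrightarrow> y \<in> U" by blast
    show "\<exists>T. openin (subtopology (full_shift A) Y) T \<and> x \<in> T \<and> T \<subseteq> U"
      using openin_cylinder[OF assms, of m x] m x R
      by (intro exI[of _ "{y \<in> Y. \<forall>k. \<bar>k\<bar> \<le> m \<longrightarrow> y k = x k}"]) auto
  qed
qed

lemma closedin_full_shiftI:
  assumes "Y \<subseteq> topspace (full_shift A)"
    and "\<And>x. x \<in> topspace (full_shift A) \<Longrightarrow> x \<notin> Y \<Longrightarrow>
      \<exists>m. \<forall>y\<in>Y. \<exists>k. \<bar>k\<bar> \<le> m \<and> y k \<noteq> x k"
  shows "closedin (full_shift A) Y"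
proof -
  have "openin (subtopology (full_shift A) (topspace (full_shift A))) (topspace (full_shift A) - Y)"
    using assms(2) by (subst openin_subtopology_full_shift_iff) fastforce+
  then show ?thesis using assms(1) by (simp add: closedin_def)
qed

lemma limitin_full_shift_eventually:
  assumes "limitin (full_shift A) f y F"
  shows "\<forall>\<^sub>F n in F. f n k = y k"
proof -
  have y: "y \<in> topspace (full_shift A)" using assms by (simp add: limitin_def)
  have "openin (full_shift A) {z \<in> topspace (full_shift A). \<forall>l. \<bar>l\<bar> \<le> \<bar>k\<bar> \<longrightarrow> z l = y l}"
    using openin_cylinder[of "topspace (full_shift A)" A "\<bar>k\<bar>" y] by simp
  then have "\<forall>\<^sub>F n in F. f n \<in> {z \<in> topspace (full_shift A). \<forall>l. \<bar>l\<bar> \<le> \<bar>k\<bar> \<longrightarrow> z l = y l}"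
    using assms y unfolding limitin_def by blast
  then show ?thesis by eventually_elim auto
qed

text \<open>The space is compact by Tychonoff and metrizable as a countable product, hence
  sequentially compact. This makes the limit sets non-empty, so that disjoint components cannot both
  contain one.\<close>

lemma full_shift_convergent_subsequence:
  assumes "finite A" and "range f \<subseteq> topspace (full_shift A)"
  shows "\<exists>y r. strict_mono (r :: nat \<Rightarrow> nat) \<and> limitin (full_shift A) (f \<circ> r) y sequentially"
proof -
  have comp: "compact_space (full_shift A)"
    using assms(1) by (simp add: full_shift_def compact_space_product_topology compact_space_discrete_topology)
  have "metrizable_space (full_shift A)"
    unfolding full_shift_def metrizable_space_product_topology
    by (auto simp: metrizable_space_discrete_topology intro: countable_subset)
  then obtain M d where "Metric_space M d" and eq: "full_shift A = Metric_space.mtopology M d"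
    unfolding metrizable_space_def by blast
  then interpret Metric_space M d by simp
  have "compactin mtopology M" using comp eq by (simp add: compact_space_def)
  then show ?thesis
    using assms(2) unfolding compactin_sequentially eq by force
qed

section \<open>Uniqueness of the finite partition into irreducible subshifts\<close>

lemma shift_map_funpow_mem_iff:
  assumes "shift_map ` Z = Z"
  shows "(shift_map ^^ n) z \<in> Z \<longleftrightarrow> z \<in> Z"
proof (induction n)
  case (Suc n)
  have "shift_map w \<in> Z \<longleftrightarrow> w \<in> Z" for w
    using assms bij_is_inj[OF bij_shift_map] by (metis inj_image_mem_iff)
  then show ?case using Suc by simp
qed simp

text \<open>A finite partition into subshifts cuts an irreducible subshift into clopen invariant pieces.\<close>

lemma irreducible_subshift_subset_part:
  assumes "finite Q" "\<And>Z. Z \<in> Q \<Longrightarrow> subshift A Z" "disjoint Q" "Y \<subseteq> \<Union>Q"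
    and Y: "irreducible_subshift A Y" and Z: "Z \<in> Q" "Y \<inter> Z \<noteq> {}"
  shows "Y \<subseteq> Z"
proof (rule ccontr)
  assume nsub: "\<not> Y \<subseteq> Z"
  have Ytop: "Y \<subseteq> topspace (full_shift A)"
    using Y by (auto simp: irreducible_subshift_def subshift_def dest: closedin_subset)
  have open_diff: "openin (subtopology (full_shift A) Y) (Y - F)" if "closedin (full_shift A) F" for F
  proof -
    have "openin (full_shift A) (topspace (full_shift A) - F)" using that by (simp add: closedin_def)
    moreover have "Y - F = (topspace (full_shift A) - F) \<inter> Y" using Ytop by blast
    ultimately show ?thesis unfolding openin_subtopology by blast
  qed
  have "closedin (full_shift A) (\<Union>(Q - {Z}))"
    using assms(1,2) by (intro closedin_Union) (auto simp: subshift_def)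
  then have U: "openin (subtopology (full_shift A) Y) (Y - \<Union>(Q - {Z}))" by (rule open_diff)
  have W: "openin (subtopology (full_shift A) Y) (Y - Z)"
    using assms(2)[OF Z(1)] by (intro open_diff) (simp add: subshift_def)
  have U_eq: "Y - \<Union>(Q - {Z}) = Y \<inter> Z"
    using assms(3,4) Z(1) by (fastforce simp: disjoint_def)
  obtain n where "(Y \<inter> Z) \<inter> (shift_map ^^ n) ` (Y - Z) \<noteq> {}"
    using Y U W Z(2) nsub unfolding irreducible_subshift_def U_eq by blast
  then obtain w where "w \<notin> Z" "(shift_map ^^ n) w \<in> Z" by blast
  then show False
    using shift_map_funpow_mem_iff assms(2)[OF Z(1)] by (metis subshift_def)
qed

text \<open>A part of \<open>P\<close> lies in a part of \<open>Q\<close>, which in turn lies in a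
  part of \<open>P\<close>; disjointness of \<open>P\<close> makes all three equal. Exchanging
  \<open>P\<close> and \<open>Q\<close> gives uniqueness of the partition.\<close>

lemma irreducible_partition_subset:
  assumes "finite P" "partition_on S P" "\<forall>Y\<in>P. irreducible_subshift A Y"
    and "finite Q" "partition_on S Q" "\<forall>Y\<in>Q. irreducible_subshift A Y"
  shows "P \<subseteq> Q"
proof
  fix Y assume Y: "Y \<in> P"
  have sub: "\<exists>Z\<in>Q'. Y \<subseteq> Z" if "Y \<in> P'" "partition_on S P'" "\<forall>Y\<in>P'. irreducible_subshift A Y"
    "finite Q'" "partition_on S Q'" "\<forall>Y\<in>Q'. irreducible_subshift A Y" for Y P' Q'
  proof -
    have "Y \<subseteq> \<Union>Q'" "Y \<noteq> {}"
      using that by (auto simp: partition_on_def)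
    then obtain Z where Z: "Z \<in> Q'" "Y \<inter> Z \<noteq> {}" by blast
    have "Y \<subseteq> Z"
    proof (rule irreducible_subshift_subset_part)
      show "finite Q'" "Z \<in> Q'" "Y \<inter> Z \<noteq> {}" "Y \<subseteq> \<Union>Q'" by fact+
      show "disjoint Q'" using that(5) by (simp add: partition_on_def)
      show "irreducible_subshift A Y" using that(1,3) by blast
      show "subshift A Z'" if "Z' \<in> Q'" for Z'
        using that \<open>\<forall>Y\<in>Q'. irreducible_subshift A Y\<close> by (auto simp: irreducible_subshift_def)
    qed
    then show ?thesis using Z by blast
  qed
  obtain Z where Z: "Z \<in> Q" "Y \<subseteq> Z"
    using sub[OF Y assms(2,3,4,5,6)] by blast
  obtain Y' where Y': "Y' \<in> P" "Z \<subseteq> Y'"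
    using sub[OF Z(1) assms(5,6,1,2,3)] by blast
  have "Y \<noteq> {}" using Y assms(2) by (auto simp: partition_on_def)
  then have "Y \<inter> Y' \<noteq> {}" using Z Y' by blast
  moreover have "disjoint P" using assms(2) by (simp add: partition_on_def)
  ultimately have "Y = Y'" using disjointD[OF _ Y Y'(1)] by blast
  then show "Y \<in> Q" using Z Y' by (metis subset_antisym)
qed


section \<open>Blocks and splicing\<close>

text \<open>Indexing relative to \<open>i\<close> and fixing the values outside the window by
  \<open>restrict\<close> make blocks at different positions comparable as functions.\<close>

definition block :: "int \<Rightarrow> (int \<Rightarrow> 'a) \<Rightarrow> int \<Rightarrow> (int \<Rightarrow> 'a)" where
  "block N x i = restrict (\<lambda>t. x (i + t)) {0..<N}"

lemma block_eq_iff: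
  "block N x i = block N y j \<longleftrightarrow> (\<forall>t. 0 \<le> t \<and> t < N \<longrightarrow> x (i + t) = y (j + t))"
  by (auto simp: block_def restrict_def fun_eq_iff)

lemma block_eqD: "block N x i = block N y j \<Longrightarrow> 0 \<le> t \<Longrightarrow> t < N \<Longrightarrow> x (i + t) = y (j + t)"
  by (simp add: block_eq_iff)

lemma block_shift: "block N (\<lambda>k. x (k + d)) i = block N x (i + d)"
  by (simp add: block_def algebra_simps)

definition splice_at :: "(int \<Rightarrow> 'a) \<Rightarrow> int \<Rightarrow> (int \<Rightarrow> 'a) \<Rightarrow> int \<Rightarrow> (int \<Rightarrow> 'a)" where
  "splice_at x i y j = (\<lambda>k. if k < i then x k else y (k - i + j))"

text \<open>A block starting at or before the seam \<open>i\<close> overruns it by at most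
  \<open>N\<close> letters, and there \<open>x\<close> and the translated \<open>y\<close> agree by
  the common block. Hence splicing creates no new blocks.\<close>

lemma block_splice_left:
  assumes "block N x i = block N y j" "k \<le> i"
  shows "block N (splice_at x i y j) k = block N x k"
  unfolding block_eq_iff
proof (intro allI impI)
  fix t assume t: "0 \<le> t \<and> t < N"
  show "splice_at x i y j (k + t) = x (k + t)"
    using block_eqD[OF assms(1), of "k + t - i"] t assms(2)
    by (auto simp: splice_at_def algebra_simps)
qed

lemma block_splice_right:
  "i \<le> k \<Longrightarrow> block N (splice_at x i y j) k = block N y (k - i + j)"
  by (auto simp: block_eq_iff splice_at_def algebra_simps)

section \<open>Periodic configurations\<close>

lemma periodic_multiple:
  fixes f :: "int \<Rightarrow> 'b"
  assumes "\<And>i. f (i + p) = f i"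
  shows "f (i + int n * p) = f i"
proof (induction n)
  case (Suc n)
  have "f (i + int (Suc n) * p) = f (i + int n * p + p)" by (simp add: algebra_simps)
  then show ?case using assms Suc by simp
qed simp

text \<open>Restriction to one period \<open>{0..<p}\<close> is injective and has finitely many
  possible values.\<close>

lemma finite_periodic:
  assumes "finite A" "p > 0"
  shows "finite {y :: int \<Rightarrow> 'a. (\<forall>k. y k \<in> A) \<and> (\<forall>k. y (k + p) = y k)}" (is "finite ?P")
proof (rule inj_on_finite)
  have mod: "y k = y (k mod p)" if "\<forall>k. y (k + p) = y k" for y :: "int \<Rightarrow> 'a" and k
  proof (cases "k div p \<ge> 0")
    case True
    then show ?thesis
      using periodic_multiple[of y p "k mod p" "nat (k div p)"] that by simp
  next
    case False
    then have "k mod p = k + int (nat (- (k div p))) * p"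
      using minus_mult_div_eq_mod[of k p] by (simp add: algebra_simps)
    then show ?thesis
      using periodic_multiple[of y p k "nat (- (k div p))"] that by simp
  qed
  show "inj_on (\<lambda>y. restrict y {0..<p}) ?P"
  proof (rule inj_onI, rule ext)
    fix y z k
    assume y: "y \<in> ?P" and z: "z \<in> ?P" and eq: "restrict y {0..<p} = restrict z {0..<p}"
    have "y (k mod p) = z (k mod p)"
      using fun_cong[OF eq, of "k mod p"] assms(2) by simp
    then show "y k = z k" using mod y z by (metis (mono_tags, lifting) mem_Collect_eq)
  qed
  show "(\<lambda>y. restrict y {0..<p}) ` ?P \<subseteq> {0..<p} \<rightarrow>\<^sub>E A" by auto
  show "finite ({0..<p} \<rightarrow>\<^sub>E A)" using assms(1) by (intro finite_PiE) auto
qed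

text \<open>By pigeonhole two iterates of the shift agree on each element, and since configurations
  are two-sided this is full periodicity. The product of two periods is a common one.\<close>

lemma finite_shift_invariant_common_period:
  assumes "finite Y" "\<And>y. y \<in> Y \<Longrightarrow> shift_map y \<in> Y" "x \<in> Y" "y \<in> Y"
  shows "\<exists>p>0. (\<forall>k. x (k + p) = x k) \<and> (\<forall>k. y (k + p) = y k)"
proof -
  have per: "\<exists>p>0. \<forall>k. z (k + p) = z k" if z: "z \<in> Y" for z :: "int \<Rightarrow> 'a"
  proof -
    have "(shift_map ^^ n) z \<in> Y" for n by (induction n) (use z assms(2) in auto)
    then have "finite (range (\<lambda>n. (shift_map ^^ n) z))"
      by (intro finite_subset[OF _ assms(1)]) auto
    then have "\<not> inj (\<lambda>n. (shift_map ^^ n) z)" using finite_imageD infinite_UNIV_nat by blast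
    then obtain a b where ab: "a < b" "(shift_map ^^ a) z = (shift_map ^^ b) z"
      by (metis (no_types, lifting) linorder_injI)
    have "z (k + int (b - a)) = z k" for k
      using fun_cong[OF ab(2), of "k - int a"] ab(1) by (simp add: shift_map_funpow algebra_simps)
    then show ?thesis using ab(1) by (intro exI[of _ "int (b - a)"]) auto
  qed
  obtain p q where p: "p > 0" "\<forall>k. x (k + p) = x k" and q: "q > 0" "\<forall>k. y (k + q) = y k"
    using per assms(3,4) by metis
  have "x (k + p * q) = x k" "y (k + p * q) = y k" for k
    using periodic_multiple[of x p k "nat q"] periodic_multiple[of y q k "nat p"] p q
    by (simp_all add: mult.commute)
  then show ?thesis using p q by (intro exI[of _ "p * q"]) auto
qed

section \<open>Recurrent blocks and their classes\<close>

text \<open>The last assumption is the finite type condition with the blocks of \<open>X\<close>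
  itself as allowed words. Shift invariance and closure under splicing follow from it.\<close>

locale block_determined =
  fixes A :: "'a set" and X :: "(int \<Rightarrow> 'a) set" and N :: int
  assumes finite_alphabet: "finite A"
    and N_pos: "N > 0"
    and values_in: "x \<in> X \<Longrightarrow> x k \<in> A"
    and in_X_if_blocks: "(\<And>i. \<exists>y\<in>X. \<exists>j. block N x i = block N y j) \<Longrightarrow> x \<in> X"
begin

text \<open>The strict inequality \<open>i < j\<close> makes \<open>reach u u\<close> a genuine
  recurrence of \<open>u\<close>.\<close>

definition reach :: "(int \<Rightarrow> 'a) \<Rightarrow> (int \<Rightarrow> 'a) \<Rightarrow> bool" where
  "reach u v \<longleftrightarrow> (\<exists>x\<in>X. \<exists>i j. i < j \<and> block N x i = u \<and> block N x j = v)"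

text \<open>These are the strongly connected components containing a cycle in the graph of blocks,
  with edges from each block to its successors in \<open>X\<close>.\<close>

definition classes :: "(int \<Rightarrow> 'a) set set" where
  "classes = {{v. reach u v \<and> reach v u} | u. reach u u}"

definition component :: "(int \<Rightarrow> 'a) set \<Rightarrow> (int \<Rightarrow> 'a) set" where
  "component K = {x \<in> X. \<forall>i. block N x i \<in> K}"

lemma X_subset: "X \<subseteq> topspace (full_shift A)"
  using values_in by (auto simp: topspace_full_shift)

lemma block_eq_imp_eq: "block N x i = block N y j \<Longrightarrow> x i = y j"
  using block_eqD[of N x i y j 0] N_pos by simp

lemma shift_in_X: "x \<in> X \<Longrightarrow> (\<lambda>k. x (k + d)) \<in> X"
  by (rule in_X_if_blocks) (auto simp: block_shift)

lemma splice_in_X: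
  assumes "x \<in> X" "y \<in> X" "block N x i = block N y j"
  shows "splice_at x i y j \<in> X"
proof (rule in_X_if_blocks)
  fix k
  show "\<exists>w\<in>X. \<exists>l. block N (splice_at x i y j) k = block N w l"
    using block_splice_left[OF assms(3), of k] block_splice_right[of i k N x y j] assms(1,2)
    by (cases "k \<le> i") fastforce+
qed

lemma reachI: "x \<in> X \<Longrightarrow> i < j \<Longrightarrow> reach (block N x i) (block N x j)"
  by (auto simp: reach_def)

text \<open>Two splices join the past of \<open>x\<close>, a path of length \<open>d\<close>
  witnessing \<open>reach\<close>, and the future of \<open>y\<close>; position \<open>j\<close> of
  \<open>y\<close> lands at \<open>i + d\<close>.\<close>

lemma connect:
  assumes "x \<in> X" "y \<in> X" "reach (block N x i) (block N y j)"
  obtains z d where "z \<in> X" "d > 0" "\<And>k. k \<le> i \<Longrightarrow> block N z k = block N x k"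
    "\<And>k. k \<ge> i + d \<Longrightarrow> block N z k = block N y (k - (i + d) + j)"
proof -
  obtain w a b where w: "w \<in> X" "a < b" "block N w a = block N x i" "block N w b = block N y j"
    using assms(3) by (auto simp: reach_def)
  define v where "v = splice_at w b y j"
  have v: "v \<in> X" unfolding v_def using w assms by (intro splice_in_X) auto
  have va: "block N x i = block N v a"
    unfolding v_def using block_splice_left[OF w(4)] w by simp
  define z where "z = splice_at x i v a"
  show ?thesis
  proof (rule that[of z "b - a"])
    show "z \<in> X" unfolding z_def using assms(1) v va by (rule splice_in_X)
    show "b - a > 0" using w by simp
    show "block N z k = block N x k" if "k \<le> i" for k
      unfolding z_def using va that by (rule block_splice_left)
    show "block N z k = block N y (k - (i + (b - a)) + j)" if "k \<ge> i + (b - a)" for k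
    proof -
      have "block N z k = block N v (k - i + a)"
        unfolding z_def using that w by (intro block_splice_right) simp
      also have "\<dots> = block N y (k - i + a - b + j)"
        unfolding v_def using that by (intro block_splice_right) simp
      finally show ?thesis by (simp add: algebra_simps)
    qed
  qed
qed

lemma reach_trans:
  assumes "reach u v" "reach v w"
  shows "reach u w"
proof -
  obtain x i j where x: "x \<in> X" "i < j" "block N x i = u" "block N x j = v"
    using assms(1) by (auto simp: reach_def)
  obtain y a b where y: "y \<in> X" "a < b" "block N y a = v" "block N y b = w"
    using assms(2) by (auto simp: reach_def)
  define z where "z = splice_at x j y a"
  have e: "block N x j = block N y a" using x y by simp
  have "z \<in> X" unfolding z_def using x(1) y(1) e by (rule splice_in_X)
  moreover have "block N z i = u"
    unfolding z_def using block_splice_left[OF e, of i] x by simp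
  moreover have "block N z (j + (b - a)) = w"
    unfolding z_def using block_splice_right[of j "j + (b - a)" N x y a] y by simp
  ultimately show ?thesis
    unfolding reach_def using x(2) y(2)
    by (intro bexI[of _ z] exI[of _ i] exI[of _ "j + (b - a)"]) auto
qed

lemma class_reach: "K \<in> classes \<Longrightarrow> u \<in> K \<Longrightarrow> v \<in> K \<Longrightarrow> reach u v"
  by (auto simp: classes_def intro: reach_trans)

lemma class_between:
  "K \<in> classes \<Longrightarrow> u \<in> K \<Longrightarrow> w \<in> K \<Longrightarrow> reach u v \<Longrightarrow> reach v w \<Longrightarrow> v \<in> K"
  by (auto simp: classes_def intro: reach_trans)

lemma class_eqI: "K \<in> classes \<Longrightarrow> L \<in> classes \<Longrightarrow> u \<in> K \<Longrightarrow> u \<in> L \<Longrightarrow> K = L"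
  by (meson class_between class_reach subsetI subset_antisym)

lemma class_nonempty: "K \<in> classes \<Longrightarrow> \<exists>u. u \<in> K"
  by (auto simp: classes_def)

lemma class_of: "reach u u \<Longrightarrow> \<exists>K\<in>classes. u \<in> K"
  by (auto simp: classes_def)

lemma blocks_in_class_between:
  assumes "K \<in> classes" "x \<in> X" "block N x i \<in> K" "block N x j \<in> K" "i \<le> k" "k \<le> j"
  shows "block N x k \<in> K"
proof (cases "k = i \<or> k = j")
  case True
  then show ?thesis using assms by blast
next
  case False
  then have "i < k" "k < j" using assms by auto
  then show ?thesis
    by (intro class_between[OF assms(1,3,4)] reachI[OF assms(2)])
qed

lemma finite_blocks: "finite {block N x i | x i. x \<in> X}"
proof (rule finite_subset)
  show "{block N x i | x i. x \<in> X} \<subseteq> {0..<N} \<rightarrow>\<^sub>E A"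
    using values_in by (auto simp: block_def)
  show "finite ({0..<N} \<rightarrow>\<^sub>E A)" using finite_alphabet by (intro finite_PiE) auto
qed

lemma finite_classes: "finite classes"
proof (rule finite_subset)
  show "classes \<subseteq> Pow {block N x i | x i. x \<in> X}"
    by (auto simp: classes_def reach_def)
  show "finite (Pow {block N x i | x i. x \<in> X})" using finite_blocks by simp
qed

text \<open>Membership in \<open>X\<close> comes for free: a block of a class reaches itself, so it
  occurs in \<open>X\<close>.\<close>

lemma in_componentI:
  assumes "K \<in> classes" "\<And>i. block N x i \<in> K"
  shows "x \<in> component K"
proof -
  have "x \<in> X"
  proof (rule in_X_if_blocks)
    fix i
    have "reach (block N x i) (block N x i)" using assms class_reach by blast
    then show "\<exists>y\<in>X. \<exists>j. block N x i = block N y j" unfolding reach_def by metis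
  qed
  then show ?thesis using assms(2) by (simp add: component_def)
qed

lemma shift_in_component: "x \<in> component K \<Longrightarrow> (\<lambda>k. x (k + d)) \<in> component K"
  by (simp add: component_def block_shift shift_in_X)

text \<open>A closed path may be shorter than the window; it is then already periodic on
  the whole range covered by its blocks.\<close>

lemma periodic_point:
  assumes "K \<in> classes" "u \<in> K"
  obtains z a p where "z \<in> component K" "p > 0" "\<And>k. block N z (k + p) = block N z k"
    "block N z a = u"
proof -
  have "reach u u" using assms class_reach by blast
  then obtain x a b where x: "x \<in> X" "a < b" "block N x a = u" "block N x b = u"
    by (auto simp: reach_def)
  define p where "p = b - a"
  have p: "p > 0" using x p_def by simp
  have xmod: "x (a + s) = x (a + s mod p)" if "0 \<le> s" "s < p + N" for s
    using that
  proof (induction "nat s" arbitrary: s rule: less_induct)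
    case less
    show ?case
    proof (cases "s < p")
      case True
      then show ?thesis using less by simp
    next
      case False
      have "x (b + (s - p)) = x (a + (s - p))"
        using block_eqD[of N x b x a "s - p"] x less False by simp
      then have "x (a + s) = x (a + (s - p))" by (simp add: p_def add.commute)
      also have "\<dots> = x (a + (s - p) mod p)"
        using False less p by (intro less) auto
      finally show ?thesis by simp
    qed
  qed
  define z where "z = (\<lambda>k. x (a + (k - a) mod p))"
  \<comment> \<open>A window of \<open>z\<close> starts at a residue below \<open>p\<close> and has
    \<open>N\<close> letters, so it stays in the range \<open>s < p + N\<close> covered by
    \<open>xmod\<close>.\<close>
  have zb: "block N z k = block N x (a + (k - a) mod p)" for k
    unfolding block_eq_iff
  proof (intro allI impI)
    fix t assume t: "0 \<le> t \<and> t < N"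
    have "z (k + t) = x (a + ((k - a) mod p + t) mod p)"
      by (simp add: z_def mod_simps algebra_simps)
    also have "\<dots> = x (a + ((k - a) mod p + t))"
      using t p by (intro xmod[symmetric]) (auto simp: add_strict_mono)
    finally show "z (k + t) = x (a + (k - a) mod p + t)" by (simp add: algebra_simps)
  qed
  have zK: "block N z k \<in> K" for k
    unfolding zb
  proof (rule blocks_in_class_between[OF assms(1) x(1)])
    show "block N x a \<in> K" "block N x b \<in> K" using x assms by auto
    show "a \<le> a + (k - a) mod p" using p by simp
    show "a + (k - a) mod p \<le> b" using pos_mod_bound[OF p, of "k - a"] p_def by simp
  qed
  show ?thesis
  proof (rule that[of z p a])
    show "z \<in> component K" using assms(1) zK by (rule in_componentI)
    show "p > 0" by fact
    show "block N z a = u" using zb[of a] x by simp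
    show "block N z (k + p) = block N z k" for k
      using mod_add_self2[of "k - a" p] by (simp add: zb algebra_simps)
  qed
qed

text \<open>Every block of a class occurs in a periodic configuration of its component, and distinct
  classes share no block.\<close>

lemma component_inj:
  assumes "K \<in> classes" "L \<in> classes" "component K = component L"
  shows "K = L"
proof -
  obtain u where "u \<in> K" using assms class_nonempty by blast
  then obtain z a where "z \<in> component K" "block N z a = u" using periodic_point assms(1) by metis
  then show ?thesis using assms class_eqI[OF assms(1,2) \<open>u \<in> K\<close>] by (auto simp: component_def)
qed

lemma blocks_eq_if_agree:
  assumes "\<forall>k. \<bar>k\<bar> \<le> m \<longrightarrow> y k = x k" "\<bar>i\<bar> + N \<le> m"
  shows "block N y i = block N x i"
  unfolding block_eq_iff
proof (intro allI impI)
  fix t assume "0 \<le> t \<and> t < N"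
  then have "\<bar>i + t\<bar> \<le> m" using assms(2) by linarith
  then show "y (i + t) = x (i + t)" using assms(1) by blast
qed

section \<open>The irreducible components as sets of configurations with blocks in one class\<close>

text \<open>A configuration near \<open>x\<close> that returns near \<open>x\<close> after
  \<open>n\<close> steps shows the block at \<open>i + 1\<close> first and the block at
  \<open>i\<close> later, so the step from \<open>i\<close> to \<open>i + 1\<close> can be
  undone.\<close>

lemma nonwandering_imp_reach:
  assumes "x \<in> nonwandering A X"
  shows "reach (block N x (i + 1)) (block N x i)"
proof -
  define m where "m = \<bar>i\<bar> + 1 + N"
  let ?U = "{y \<in> X. \<forall>k. \<bar>k\<bar> \<le> m \<longrightarrow> y k = x k}"
  have "x \<in> ?U" using assms by (simp add: nonwandering_def)
  then have "\<exists>V. openin (subtopology (full_shift A) X) V \<and> x \<in> V \<and> V \<subseteq> ?U"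
    using openin_cylinder[OF X_subset, of m x] by (intro exI[of _ ?U]) simp
  moreover have "?U \<subseteq> X" by blast
  ultimately obtain n where n: "n \<ge> 1" "?U \<inter> (shift_map ^^ n) ` ?U \<noteq> {}"
    using assms unfolding nonwandering_def by (smt (verit) mem_Collect_eq)
  then obtain y where y: "y \<in> X" "\<forall>k. \<bar>k\<bar> \<le> m \<longrightarrow> y k = x k"
    and ys: "\<forall>k. \<bar>k\<bar> \<le> m \<longrightarrow> (\<lambda>k. y (k + int n)) k = x k"
    by (auto simp: shift_map_funpow)
  have y1: "block N y (i + 1) = block N x (i + 1)"
    using blocks_eq_if_agree[OF y(2), of "i + 1"] by (simp add: m_def)
  have y2: "block N y (i + int n) = block N x i"
    using blocks_eq_if_agree[OF ys, of i] unfolding block_shift by (simp add: m_def)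
  have y3: "block N y (i + 1 + int n) = block N x (i + 1)"
    using blocks_eq_if_agree[OF ys, of "i + 1"] unfolding block_shift by (simp add: m_def)
  show ?thesis
  \<comment> \<open>For \<open>n = 1\<close> the positions \<open>i + 1\<close> and
    \<open>i + int n\<close> coincide. The two blocks of \<open>x\<close> are then equal, and
    \<open>y3\<close> supplies the later occurrence at \<open>i + 2\<close>.\<close>
  proof (cases "n = 1")
    case True
    then show ?thesis using reachI[OF y(1), of "i + 1" "i + 2"] y1 y2 y3 by (simp add: add.commute)
  next
    case False
    then show ?thesis using reachI[OF y(1), of "i + 1" "i + int n"] n y1 y2 by simp
  qed
qed

text \<open>Undoing single steps repeatedly shows that all blocks of \<open>x\<close> reach each
  other, so they form part of a single class.\<close>

lemma nonwandering_subset_components: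
  assumes "x \<in> nonwandering A X"
  shows "\<exists>K\<in>classes. x \<in> component K"
proof -
  have x: "x \<in> X" using assms by (simp add: nonwandering_def)
  have down: "reach (block N x (j + int n)) (block N x j)" for j n
  proof (induction n)
    case 0
    show ?case using reach_trans[OF reachI[OF x] nonwandering_imp_reach[OF assms]] by simp
  next
    case (Suc n)
    then show ?case
      using reach_trans[OF nonwandering_imp_reach[OF assms, of "j + int n"]]
      by (simp add: algebra_simps)
  qed
  have all: "reach (block N x i) (block N x j)" for i j
  proof (cases "i < j")
    case True
    then show ?thesis using reachI x by blast
  next
    case False
    then show ?thesis using down[of j "nat (i - j)"] by simp
  qed
  obtain K where K: "K \<in> classes" "block N x 0 \<in> K" using class_of all by blast
  then have "block N x i \<in> K" for i using class_between all by blast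
  then show ?thesis using K in_componentI by blast
qed

text \<open>Leading the end of a window of \<open>x\<close> back to its beginning produces a
  configuration that shows the window twice.\<close>

lemma component_subset_nonwandering:
  assumes "K \<in> classes" "x \<in> component K"
  shows "x \<in> nonwandering A X"
proof -
  have x: "x \<in> X" "\<And>i. block N x i \<in> K" using assms(2) by (auto simp: component_def)
  have "\<exists>n\<ge>1. U \<inter> (shift_map ^^ n) ` U \<noteq> {}"
    if U: "U \<subseteq> X" "openin (subtopology (full_shift A) X) V" "x \<in> V" "V \<subseteq> U" for U V
  proof -
    obtain m where m: "\<forall>y\<in>X. (\<forall>k. \<bar>k\<bar> \<le> m \<longrightarrow> y k = x k) \<longrightarrow> y \<in> V"
      using U(2,3) unfolding openin_subtopology_full_shift_iff[OF X_subset] by blast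
    have "reach (block N x m) (block N x (- m))" using class_reach assms(1) x by blast
    then obtain z d where z: "z \<in> X" "d > 0" "\<And>k. k \<le> m \<Longrightarrow> block N z k = block N x k"
      "\<And>k. k \<ge> m + d \<Longrightarrow> block N z k = block N x (k - (m + d) + - m)"
      using connect[OF x(1) x(1)] by blast
    \<comment> \<open>For \<open>m \<ge> 0\<close> this is \<open>2 * m + d\<close>: the copy of
      position \<open>-m\<close> lies at \<open>m + d\<close>. For negative \<open>m\<close> the
      window is empty, \<open>V\<close> is all of \<open>X\<close>, and a single shift
      suffices.\<close>
    define n where "n = nat (\<bar>m\<bar> + \<bar>m\<bar> + d)"
    show ?thesis
    proof (cases "m < 0")
      case True
      then show ?thesis using m U x(1) shift_in_X[OF x(1), of 1]
        by (intro exI[of _ 1]) (force simp: shift_map_def)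
    next
      case False
      have "z \<in> U" using m z(1) U block_eq_imp_eq[OF z(3)] by (auto simp: abs_le_iff)
      moreover have "(\<lambda>k. z (k + int n)) \<in> U"
      proof -
        have "z (k + int n) = x k" if "\<bar>k\<bar> \<le> m" for k
          using block_eq_imp_eq[OF z(4)[of "k + int n"]] that False z(2) by (simp add: n_def)
        then have "(\<lambda>k. z (k + int n)) \<in> V" using m shift_in_X[OF z(1), of "int n"] by simp
        then show ?thesis using U(4) by blast
      qed
      ultimately show ?thesis
        using z(2) by (intro exI[of _ n]) (auto simp: shift_map_funpow n_def)
    qed
  qed
  then show ?thesis using x(1) unfolding nonwandering_def by blast
qed

lemma subshift_component:
  assumes "K \<in> classes"
  shows "subshift A (component K)"
  unfolding subshift_def
proof
  show "closedin (full_shift A) (component K)"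
  proof (rule closedin_full_shiftI)
    show "component K \<subseteq> topspace (full_shift A)" using X_subset by (auto simp: component_def)
    fix x assume "x \<notin> component K"
    then obtain i where i: "block N x i \<notin> K" using in_componentI[OF assms] by blast
    have "\<exists>k. \<bar>k\<bar> \<le> \<bar>i\<bar> + N \<and> y k \<noteq> x k" if "y \<in> component K" for y
    proof (rule ccontr)
      assume "\<not> ?thesis"
      then have "block N y i = block N x i" by (intro blocks_eq_if_agree[of "\<bar>i\<bar> + N"]) auto
      moreover have "block N y i \<in> K" using that by (simp add: component_def)
      ultimately show False using i by simp
    qed
    then show "\<exists>m. \<forall>y\<in>component K. \<exists>k. \<bar>k\<bar> \<le> m \<and> y k \<noteq> x k" by blast
  qed
  show "shift_map ` component K = component K"
  proof
    show "shift_map ` component K \<subseteq> component K"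
      using shift_in_component by (auto simp: shift_map_def)
    show "component K \<subseteq> shift_map ` component K"
    proof
      fix x assume "x \<in> component K"
      then have "(\<lambda>k. x (k + - 1)) \<in> component K" by (rule shift_in_component)
      moreover have "x = shift_map (\<lambda>k. x (k + - 1))" by (simp add: shift_map_def)
      ultimately show "x \<in> shift_map ` component K" by blast
    qed
  qed
qed

text \<open>Any window of \<open>w\<close> can be led to any window of \<open>x\<close> inside
  \<open>X\<close>. The blocks on the connecting path lie between blocks of \<open>K\<close>, hence
  in \<open>K\<close>, so the path stays in the component.\<close>

lemma irreducible_component:
  assumes "K \<in> classes"
  shows "irreducible_subshift A (component K)"
  unfolding irreducible_subshift_def
proof (intro conjI allI impI)
  show "subshift A (component K)" using assms by (rule subshift_component)
  show "component K \<noteq> {}"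
    using periodic_point[OF assms] class_nonempty[OF assms] by blast
  have top: "component K \<subseteq> topspace (full_shift A)" using X_subset by (auto simp: component_def)
  fix U W
  assume UW: "openin (subtopology (full_shift A) (component K)) U \<and> U \<noteq> {} \<and>
      openin (subtopology (full_shift A) (component K)) W \<and> W \<noteq> {}"
  have cyl: "\<exists>x l. x \<in> component K \<and>
      (\<forall>y\<in>component K. (\<forall>k. \<bar>k\<bar> \<le> l \<longrightarrow> y k = x k) \<longrightarrow> y \<in> V)"
    if V: "openin (subtopology (full_shift A) (component K)) V" "V \<noteq> {}" for V
    using V unfolding openin_subtopology_full_shift_iff[OF top] by blast
  obtain x l where x: "x \<in> component K"
    and xU: "\<And>y. y \<in> component K \<Longrightarrow> (\<forall>k. \<bar>k\<bar> \<le> l \<longrightarrow> y k = x k) \<Longrightarrow> y \<in> U"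
    using cyl[of U] UW by blast
  obtain w m where w: "w \<in> component K"
    and wW: "\<And>y. y \<in> component K \<Longrightarrow> (\<forall>k. \<bar>k\<bar> \<le> m \<longrightarrow> y k = w k) \<Longrightarrow> y \<in> W"
    using cyl[of W] UW by blast
  have wx: "reach (block N w \<bar>m\<bar>) (block N x (- \<bar>l\<bar>))"
    using class_reach assms x w by (auto simp: component_def)
  have wX: "w \<in> X" and xX: "x \<in> X" using x w by (auto simp: component_def)
  obtain z d where z: "z \<in> X" "d > 0" "\<And>k. k \<le> \<bar>m\<bar> \<Longrightarrow> block N z k = block N w k"
    "\<And>k. k \<ge> \<bar>m\<bar> + d \<Longrightarrow> block N z k = block N x (k - (\<bar>m\<bar> + d) + - \<bar>l\<bar>)"
    using connect[OF wX xX wx] by blast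
  have xw: "block N x k \<in> K" "block N w k \<in> K" for k using x w by (auto simp: component_def)
  have "block N z k \<in> K" for k
  proof -
    consider "k \<le> \<bar>m\<bar>" | "k \<ge> \<bar>m\<bar> + d" | "\<bar>m\<bar> \<le> k" "k \<le> \<bar>m\<bar> + d" by linarith
    then show ?thesis
    proof cases
      case 3
      show ?thesis
        by (rule blocks_in_class_between[OF assms z(1) _ _ 3]) (simp_all add: z(3,4) xw)
    qed (simp_all add: z(3,4) xw)
  qed
  then have zK: "z \<in> component K" by (rule in_componentI[OF assms])
  define n where "n = nat (\<bar>m\<bar> + d + \<bar>l\<bar>)"
  have "z \<in> W"
    using block_eq_imp_eq[OF z(3)] by (intro wW[OF zK]) simp
  moreover have "(\<lambda>k. z (k + int n)) \<in> U"
  proof (rule xU)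
    show "(\<lambda>k. z (k + int n)) \<in> component K" using zK by (rule shift_in_component)
    show "\<forall>k. \<bar>k\<bar> \<le> l \<longrightarrow> z (k + int n) = x k"
    proof (intro allI impI)
      fix k assume "\<bar>k\<bar> \<le> l"
      then show "z (k + int n) = x k"
        using block_eq_imp_eq[OF z(4)[of "k + int n"]] z(2) by (simp add: n_def)
    qed
  qed
  ultimately have "(shift_map ^^ n) z \<in> U \<inter> (shift_map ^^ n) ` W" by (simp add: shift_map_funpow)
  moreover have "n \<ge> 1" using z(2) by (simp add: n_def)
  ultimately show "\<exists>n\<ge>1. U \<inter> (shift_map ^^ n) ` W \<noteq> {}" by blast
qed

lemma partition_components: "partition_on (nonwandering A X) (component ` classes)"
proof (rule partition_onI)
  show "\<Union>(component ` classes) = nonwandering A X"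
    using nonwandering_subset_components component_subset_nonwandering by blast
  show "{} \<notin> component ` classes"
    using irreducible_component by (auto simp: irreducible_subshift_def)
  fix C D assume "C \<in> component ` classes" "D \<in> component ` classes" "C \<noteq> D"
  then obtain K L where KL: "K \<in> classes" "L \<in> classes" "K \<noteq> L" "C = component K" "D = component L"
    by blast
  have False if "x \<in> C" "x \<in> D" for x
    using class_eqI[OF KL(1,2), of "block N x 0"] that KL by (simp add: component_def)
  then show "disjnt C D" by (auto simp: disjnt_def)
qed

text \<open>Evaluates the definite description: the components of the classes form such a partition,
  and mutual inclusion excludes any other.\<close>

lemma irreducible_components_eq: "irreducible_components A X = component ` classes"
  unfolding irreducible_components_def
proof (rule the_equality)
  show *: "finite (component ` classes) \<and> partition_on (nonwandering A X) (component ` classes) \<and>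
      (\<forall>Y\<in>component ` classes. irreducible_subshift A Y)"
    using finite_classes partition_components irreducible_component by blast
  fix P assume "finite P \<and> partition_on (nonwandering A X) P \<and> (\<forall>Y\<in>P. irreducible_subshift A Y)"
  then show "P = component ` classes"
    using * irreducible_partition_subset by (metis subset_antisym)
qed

section \<open>Limit sets and the classes at the two ends of a configuration\<close>

text \<open>By pigeonhole some block \<open>u\<close> occurs arbitrarily far to the left. It is
  therefore recurrent, and every block before an occurrence at \<open>M\<close> lies between two
  occurrences of \<open>u\<close>.\<close>

lemma past_class:
  assumes "x \<in> X"
  obtains K M where "K \<in> classes" "\<And>k. k \<le> M \<Longrightarrow> block N x k \<in> K"
proof -
  have "finite (range (\<lambda>n. block N x (- int n)))"
    by (rule finite_subset[OF _ finite_blocks]) (use assms in auto)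
  then obtain u where u: "\<exists>\<^sub>\<infinity>n. block N x (- int n) = u"
    using pigeonhole_infinite[of UNIV "\<lambda>n. block N x (- int n)"] infinite_UNIV_nat
    by (auto simp: INFM_iff_infinite)
  have early: "\<exists>i<k. block N x i = u" for k
  proof -
    obtain n where "n > nat \<bar>k\<bar>" "block N x (- int n) = u"
      using u unfolding INFM_nat by blast
    then show ?thesis by (intro exI[of _ "- int n"]) auto
  qed
  obtain M where M: "block N x M = u" using early by blast
  have "reach u u" using early[of M] reachI[OF assms] M by metis
  then obtain K where K: "K \<in> classes" "u \<in> K" using class_of by blast
  show ?thesis
  proof (rule that[OF K(1), of M])
    fix k assume "k \<le> M"
    then show "block N x k \<in> K"
      using early[of k] blocks_in_class_between[OF K(1) assms] M K(2) by (metis less_imp_le)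
  qed
qed

lemma future_class:
  assumes "x \<in> X"
  obtains K M where "K \<in> classes" "\<And>k. k \<ge> M \<Longrightarrow> block N x k \<in> K"
proof -
  have "finite (range (\<lambda>n. block N x (int n)))"
    by (rule finite_subset[OF _ finite_blocks]) (use assms in auto)
  then obtain u where u: "\<exists>\<^sub>\<infinity>n. block N x (int n) = u"
    using pigeonhole_infinite[of UNIV "\<lambda>n. block N x (int n)"] infinite_UNIV_nat
    by (auto simp: INFM_iff_infinite)
  have late: "\<exists>i>k. block N x i = u" for k
  proof -
    obtain n where "n > nat \<bar>k\<bar>" "block N x (int n) = u"
      using u unfolding INFM_nat by blast
    then show ?thesis by (intro exI[of _ "int n"]) auto
  qed
  obtain M where M: "block N x M = u" using late by blast
  have "reach u u" using late[of M] reachI[OF assms] M by metis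
  then obtain K where K: "K \<in> classes" "u \<in> K" using class_of by blast
  show ?thesis
  proof (rule that[OF K(1), of M])
    fix k assume "k \<ge> M"
    then show "block N x k \<in> K"
      using late[of k] blocks_in_class_between[OF K(1) assms] M K(2) by (metis less_imp_le)
  qed
qed

text \<open>Each block of the limit involves finitely many coordinates, so it eventually equals the
  corresponding block of \<open>f n\<close>.\<close>

lemma limit_in_component:
  assumes "K \<in> classes" "limitin (full_shift A) f y F" "F \<noteq> bot"
    and "\<And>i. \<forall>\<^sub>F n in F. block N (f n) i \<in> K"
  shows "y \<in> component K"
proof (rule in_componentI[OF assms(1)])
  fix i
  have "\<forall>\<^sub>F n in F. \<forall>t\<in>{0..<N}. f n (i + t) = y (i + t)"
    by (rule eventually_ball_finite) (auto intro: limitin_full_shift_eventually[OF assms(2)])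
  then have "\<forall>\<^sub>F n in F. block N y i \<in> K"
    using assms(4)[of i]
  proof eventually_elim
    case (elim n)
    then have "block N (f n) i = block N y i" by (auto simp: block_eq_iff)
    then show ?case using elim by simp
  qed
  then show "block N y i \<in> K" using assms(3) by (simp add: eventually_const)
qed

text \<open>An element of \<open>S\<close> has a block in the class of any component containing
  \<open>S\<close>, which leaves only one class.\<close>

lemma the_component_containing:
  assumes "K \<in> classes" "S \<subseteq> component K" "S \<noteq> {}"
  shows "(THE C. C \<in> irreducible_components A X \<and> S \<subseteq> C) = component K"
proof (rule the_equality)
  show "component K \<in> irreducible_components A X \<and> S \<subseteq> component K"
    using assms by (simp add: irreducible_components_eq)
  fix C assume C: "C \<in> irreducible_components A X \<and> S \<subseteq> C"
  then obtain L where L: "L \<in> classes" "C = component L" by (auto simp: irreducible_components_eq)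
  obtain y where "y \<in> S" using assms by blast
  then have "block N y 0 \<in> K" "block N y 0 \<in> L" using C L assms by (auto simp: component_def)
  then show "C = component K" using L assms class_eqI by blast
qed

text \<open>Every fixed window of the backward iterates eventually lies left of \<open>M\<close>, so
  all limits have their blocks in \<open>K\<close>. With \<open>past_class\<close> this makes
  \<open>C_alpha\<close> computable from blocks.\<close>

lemma C_alpha_eq:
  assumes "x \<in> X" "K \<in> classes" "\<And>k. k \<le> M \<Longrightarrow> block N x k \<in> K"
  shows "C_alpha A X x = component K"
  unfolding C_alpha_def
proof (rule the_component_containing[OF assms(2)])
  show "alpha_limit A x \<subseteq> component K"
  proof
    fix y assume "y \<in> alpha_limit A x"
    then obtain r :: "nat \<Rightarrow> nat" where r: "strict_mono r"
      "limitin (full_shift A) (\<lambda>k. (inv shift_map ^^ r k) x) y sequentially"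
      by (auto simp: alpha_limit_def)
    show "y \<in> component K"
    proof (rule limit_in_component[OF assms(2) r(2)])
      fix i
      have "\<forall>\<^sub>F n in sequentially. n \<ge> nat (i - M)" by (rule eventually_ge_at_top)
      then show "\<forall>\<^sub>F n in sequentially. block N ((inv shift_map ^^ r n) x) i \<in> K"
      proof eventually_elim
        case (elim n)
        then have "i - int (r n) \<le> M" using seq_suble[OF r(1), of n] by linarith
        then show ?case
          using assms(3) block_shift[of N x "- int (r n)" i] by (simp add: inv_shift_map_funpow)
      qed
    qed simp
  qed
  have "range (\<lambda>n. (inv shift_map ^^ n) x) \<subseteq> topspace (full_shift A)"
    using assms(1) values_in by (auto simp: topspace_full_shift inv_shift_map_funpow)
  from full_shift_convergent_subsequence[OF finite_alphabet this]
  show "alpha_limit A x \<noteq> {}" by (auto simp: alpha_limit_def o_def)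
qed

lemma C_omega_eq:
  assumes "x \<in> X" "K \<in> classes" "\<And>k. k \<ge> M \<Longrightarrow> block N x k \<in> K"
  shows "C_omega A X x = component K"
  unfolding C_omega_def
proof (rule the_component_containing[OF assms(2)])
  show "omega_limit A x \<subseteq> component K"
  proof
    fix y assume "y \<in> omega_limit A x"
    then obtain r :: "nat \<Rightarrow> nat" where r: "strict_mono r"
      "limitin (full_shift A) (\<lambda>k. (shift_map ^^ r k) x) y sequentially"
      by (auto simp: omega_limit_def)
    show "y \<in> component K"
    proof (rule limit_in_component[OF assms(2) r(2)])
      fix i
      have "\<forall>\<^sub>F n in sequentially. n \<ge> nat (M - i)" by (rule eventually_ge_at_top)
      then show "\<forall>\<^sub>F n in sequentially. block N ((shift_map ^^ r n) x) i \<in> K"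
      proof eventually_elim
        case (elim n)
        then have "i + int (r n) \<ge> M" using seq_suble[OF r(1), of n] by linarith
        then show ?case
          using assms(3) block_shift[of N x "int (r n)" i] by (simp add: shift_map_funpow)
      qed
    qed simp
  qed
  have "range (\<lambda>n. (shift_map ^^ n) x) \<subseteq> topspace (full_shift A)"
    using assms(1) values_in by (auto simp: topspace_full_shift shift_map_funpow)
  from full_shift_convergent_subsequence[OF finite_alphabet this]
  show "omega_limit A x \<noteq> {}" by (auto simp: omega_limit_def o_def)
qed

section \<open>Determined pasts and futures, and finite components\<close>

text \<open>The case \<open>y = w\<close> is included, so two occurrences of \<open>u\<close> in one
  configuration have equal pasts as well.\<close>

definition past_determined :: "(int \<Rightarrow> 'a) \<Rightarrow> bool" where
  "past_determined u \<longleftrightarrow> (\<forall>y\<in>X. \<forall>w\<in>X. \<forall>j l. block N y j = u \<longrightarrow> block N w l = u \<longrightarrow>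
     (\<forall>t\<ge>0. block N y (j - t) = block N w (l - t)))"

definition future_determined :: "(int \<Rightarrow> 'a) \<Rightarrow> bool" where
  "future_determined u \<longleftrightarrow> (\<forall>y\<in>X. \<forall>w\<in>X. \<forall>j l. block N y j = u \<longrightarrow> block N w l = u \<longrightarrow>
     (\<forall>t\<ge>0. block N y (j + t) = block N w (l + t)))"

text \<open>Continuing both pasts after \<open>i\<close> by the same configuration of
  \<open>K\<close> gives two elements of a finite component. They have a common period and agree to
  the right of \<open>i\<close>, hence everywhere.\<close>

lemma finite_component_past_unique:
  assumes K: "K \<in> classes" "finite (component K)"
    and xy: "x \<in> X" "y \<in> X" "block N x i = block N y i"
    and xK: "\<And>k. k \<le> i \<Longrightarrow> block N x k \<in> K" and yK: "\<And>k. k \<le> i \<Longrightarrow> block N y k \<in> K"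
    and k: "k \<le> i"
  shows "block N x k = block N y k"
proof -
  obtain z a where z: "z \<in> component K" "block N z a = block N x i"
    using periodic_point[OF K(1) xK[OF order_refl]] by metis
  have in_K: "splice_at w i z a \<in> component K"
    if w: "block N w i = block N z a" "\<And>k. k \<le> i \<Longrightarrow> block N w k \<in> K" for w
  proof (rule in_componentI[OF K(1)])
    fix k
    show "block N (splice_at w i z a) k \<in> K"
      using block_splice_left[OF w(1), of k] block_splice_right[of i k N w z a] w(2) z(1)
      by (cases "k \<le> i") (auto simp: component_def)
  qed
  have eqs: "block N x i = block N z a" "block N y i = block N z a" using z xy by auto
  have mem: "splice_at x i z a \<in> component K" "splice_at y i z a \<in> component K"
    using in_K eqs xK yK by blast+
  have "shift_map w \<in> component K" if "w \<in> component K" for w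
    using shift_in_component[OF that, of 1] by (simp add: shift_map_def)
  then obtain p where p: "p > 0"
    "\<forall>k. splice_at x i z a (k + p) = splice_at x i z a k"
    "\<forall>k. splice_at y i z a (k + p) = splice_at y i z a k"
    using finite_shift_invariant_common_period[OF K(2) _ mem] by blast
  have "splice_at x i z a k = splice_at y i z a k" for k
  proof -
    define n where "n = nat \<bar>i - k\<bar>"
    have "\<bar>i - k\<bar> * 1 \<le> \<bar>i - k\<bar> * p" using p(1) by (intro mult_left_mono) auto
    then have "k + int n * p \<ge> i" by (simp add: n_def)
    then have "splice_at x i z a (k + int n * p) = splice_at y i z a (k + int n * p)"
      by (simp add: splice_at_def)
    then show ?thesis
      using periodic_multiple[of "splice_at x i z a" p k n] periodic_multiple[of "splice_at y i z a" p k n] p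
      by simp
  qed
  then have "splice_at x i z a = splice_at y i z a" by blast
  then show ?thesis
    using block_splice_left[OF eqs(1) k] block_splice_left[OF eqs(2) k] by simp
qed

lemma finite_component_future_unique:
  assumes K: "K \<in> classes" "finite (component K)"
    and xy: "x \<in> X" "y \<in> X" "block N x i = block N y i"
    and xK: "\<And>k. k \<ge> i \<Longrightarrow> block N x k \<in> K" and yK: "\<And>k. k \<ge> i \<Longrightarrow> block N y k \<in> K"
    and k: "k \<ge> i"
  shows "block N x k = block N y k"
proof -
  obtain z a where z: "z \<in> component K" "block N z a = block N x i"
    using periodic_point[OF K(1) xK[OF order_refl]] by metis
  have in_K: "splice_at z a w i \<in> component K"
    if w: "block N z a = block N w i" "\<And>k. k \<ge> i \<Longrightarrow> block N w k \<in> K" for w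
  proof (rule in_componentI[OF K(1)])
    fix k
    show "block N (splice_at z a w i) k \<in> K"
      using block_splice_left[OF w(1), of k] block_splice_right[of a k N z w i] w(2) z(1)
      by (cases "k \<le> a") (auto simp: component_def)
  qed
  have eqs: "block N z a = block N x i" "block N z a = block N y i" using z xy by auto
  have mem: "splice_at z a x i \<in> component K" "splice_at z a y i \<in> component K"
    using in_K eqs xK yK by blast+
  have "shift_map w \<in> component K" if "w \<in> component K" for w
    using shift_in_component[OF that, of 1] by (simp add: shift_map_def)
  then obtain p where p: "p > 0"
    "\<forall>k. splice_at z a x i (k + p) = splice_at z a x i k"
    "\<forall>k. splice_at z a y i (k + p) = splice_at z a y i k"
    using finite_shift_invariant_common_period[OF K(2) _ mem] by blast
  have "splice_at z a x i k = splice_at z a y i k" for k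
  proof -
    \<comment> \<open>The additional 1 moves \<open>k - int n * p\<close> strictly left of
      \<open>a\<close>, since \<open>splice_at\<close> uses its first argument only there.\<close>
    define n where "n = nat (\<bar>a - k\<bar> + 1)"
    have "(\<bar>a - k\<bar> + 1) * 1 \<le> (\<bar>a - k\<bar> + 1) * p" using p(1) by (intro mult_left_mono) auto
    moreover have "int n = \<bar>a - k\<bar> + 1" by (simp add: n_def)
    ultimately have "\<bar>a - k\<bar> + 1 \<le> int n * p" by simp
    then have "k - int n * p < a" by linarith
    then have "splice_at z a x i (k - int n * p) = splice_at z a y i (k - int n * p)"
      by (simp add: splice_at_def)
    then show ?thesis
      using periodic_multiple[of "splice_at z a x i" p "k - int n * p" n]
        periodic_multiple[of "splice_at z a y i" p "k - int n * p" n] p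
      by simp
  qed
  then have "splice_at z a x i = splice_at z a y i" by blast
  then show ?thesis
    using block_splice_right[of a "k - i + a" N z x i] block_splice_right[of a "k - i + a" N z y i] k
    by simp
qed

text \<open>Any \<open>y\<close> in the component can be continued to \<open>u\<close>, and what
  precedes \<open>u\<close> is the past of the periodic \<open>z\<close>. So \<open>y\<close>
  inherits the period \<open>p\<close>, which does not depend on \<open>y\<close>.\<close>

lemma finite_component_if_past_determined:
  assumes K: "K \<in> classes" "u \<in> K" and u: "past_determined u"
  shows "finite (component K)"
proof -
  obtain z a p where z: "z \<in> component K" "p > 0" "\<And>k. block N z (k + p) = block N z k"
    "block N z a = u"
    using periodic_point[OF K] by metis
  have zX: "z \<in> X" using z by (simp add: component_def)
  have "y (k + p) = y k" if y: "y \<in> component K" for y k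
  proof -
    have yX: "y \<in> X" using y by (simp add: component_def)
    have "reach (block N y (k + p)) (block N z a)"
      using y z K by (auto simp: component_def intro: class_reach)
    then obtain w d where w: "w \<in> X" "d > 0"
      "\<And>l. l \<le> k + p \<Longrightarrow> block N w l = block N y l"
      "\<And>l. l \<ge> k + p + d \<Longrightarrow> block N w l = block N z (l - (k + p + d) + a)"
      using connect[OF yX zX] by blast
    have "block N w (k + p + d) = u" using w(4)[of "k + p + d"] z(4) by simp
    then have past: "block N w (k + p + d - t) = block N z (a - t)" if "t \<ge> 0" for t
      using u w(1) zX z(4) that unfolding past_determined_def by blast
    \<comment> \<open>The offsets \<open>d\<close> and \<open>d + p\<close> before the occurrence of
      \<open>u\<close> are the positions \<open>k + p\<close> and \<open>k\<close>, where
      \<open>w\<close> still shows the blocks of \<open>y\<close>.\<close>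
    have "block N y (k + p) = block N z (a - d)" using past[of d] w by simp
    also have "\<dots> = block N z (a - (d + p))" using z(3)[of "a - (d + p)"] by simp
    also have "\<dots> = block N y k" using past[of "d + p"] w z(2) by simp
    finally show ?thesis by (rule block_eq_imp_eq)
  qed
  then have "component K \<subseteq> {y. (\<forall>k. y k \<in> A) \<and> (\<forall>k. y (k + p) = y k)}"
    using values_in by (auto simp: component_def)
  then show ?thesis using finite_periodic[OF finite_alphabet z(2)] finite_subset by blast
qed

lemma finite_component_if_future_determined:
  assumes K: "K \<in> classes" "u \<in> K" and u: "future_determined u"
  shows "finite (component K)"
proof -
  obtain z a p where z: "z \<in> component K" "p > 0" "\<And>k. block N z (k + p) = block N z k"
    "block N z a = u"
    using periodic_point[OF K] by metis
  have zX: "z \<in> X" using z by (simp add: component_def)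
  have "y (k + p) = y k" if y: "y \<in> component K" for y k
  proof -
    have yX: "y \<in> X" using y by (simp add: component_def)
    have "reach (block N z a) (block N y k)"
      using y z K by (auto simp: component_def intro: class_reach)
    then obtain w d where w: "w \<in> X" "d > 0"
      "\<And>l. l \<le> a \<Longrightarrow> block N w l = block N z l"
      "\<And>l. l \<ge> a + d \<Longrightarrow> block N w l = block N y (l - (a + d) + k)"
      using connect[OF zX yX] by blast
    have "block N w a = u" using w(3) z(4) by simp
    then have future: "block N w (a + t) = block N z (a + t)" if "t \<ge> 0" for t
      using u w(1) zX z(4) that unfolding future_determined_def by blast
    have "block N y (k + p) = block N z (a + (d + p))"
      using future[of "d + p"] w(2) w(4)[of "a + (d + p)"] z(2) by (simp add: add.commute)
    also have "\<dots> = block N z (a + d)" using z(3)[of "a + d"] by (simp add: add.assoc)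
    also have "\<dots> = block N y k" using future[of d] w(2) w(4)[of "a + d"] by simp
    finally show ?thesis by (rule block_eq_imp_eq)
  qed
  then have "component K \<subseteq> {y. (\<forall>k. y k \<in> A) \<and> (\<forall>k. y (k + p) = y k)}"
    using values_in by (auto simp: component_def)
  then show ?thesis using finite_periodic[OF finite_alphabet z(2)] finite_subset by blast
qed

section \<open>The order on components in terms of blocks\<close>

lemma component_leE:
  assumes "component_le A X (component K) (component L)" "K \<in> classes" "L \<in> classes"
  obtains y M M' where "y \<in> X" "\<And>k. k \<le> M \<Longrightarrow> block N y k \<in> K" "\<And>k. k \<ge> M' \<Longrightarrow> block N y k \<in> L"
proof -
  obtain y where y: "y \<in> X" "C_alpha A X y = component K" "C_omega A X y = component L"
    using assms(1) by (auto simp: component_le_def)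
  obtain K' M where K': "K' \<in> classes" "\<And>k. k \<le> M \<Longrightarrow> block N y k \<in> K'"
    using past_class[OF y(1)] by blast
  obtain L' M' where L': "L' \<in> classes" "\<And>k. k \<ge> M' \<Longrightarrow> block N y k \<in> L'"
    using future_class[OF y(1)] by blast
  have "K' = K" using C_alpha_eq[OF y(1) K'] y component_inj K' assms by simp
  moreover have "L' = L" using C_omega_eq[OF y(1) L'] y component_inj L' assms by simp
  ultimately show ?thesis using that y K' L' by blast
qed

text \<open>A segment of \<open>y\<close> suffices: its left end is extended by a past in
  \<open>component K\<close>, its right end by a future in \<open>component L\<close>.\<close>

lemma component_leI:
  assumes "K \<in> classes" "L \<in> classes" "y \<in> X" "block N y i \<in> K" "block N y j \<in> L" "i \<le> j"
  shows "component_le A X (component K) (component L)"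
proof -
  obtain v a where v: "v \<in> component K" "block N v a = block N y i"
    using periodic_point[OF assms(1,4)] by metis
  obtain w b where w: "w \<in> component L" "block N w b = block N y j"
    using periodic_point[OF assms(2,5)] by metis
  have vwX: "v \<in> X" "w \<in> X" using v w by (auto simp: component_def)
  define x where "x = splice_at y j w b"
  have x: "x \<in> X" unfolding x_def using assms(3) vwX w by (intro splice_in_X) auto
  have e: "block N v a = block N x i"
    unfolding x_def using block_splice_left[of N y j w b i] v w assms(6) by simp
  define z where "z = splice_at v a x i"
  have z: "z \<in> X" unfolding z_def using vwX(1) x e by (rule splice_in_X)
  have "block N z k \<in> K" if "k \<le> a" for k
    unfolding z_def using block_splice_left[OF e that] v by (simp add: component_def)
  then have "C_alpha A X z = component K" by (rule C_alpha_eq[OF z assms(1)])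
  moreover have "block N z k \<in> L" if "k \<ge> a + (j - i)" for k
  proof -
    have "block N z k = block N x (k - a + i)"
      unfolding z_def using that assms(6) by (intro block_splice_right) simp
    also have "\<dots> = block N w (k - a + i - j + b)"
      unfolding x_def using that by (intro block_splice_right) simp
    finally show ?thesis using w by (simp add: component_def)
  qed
  then have "C_omega A X z = component L" by (rule C_omega_eq[OF z assms(2)])
  ultimately show ?thesis using z by (auto simp: component_le_def)
qed

text \<open>A configuration leading from \<open>L\<close> into \<open>K\<close> can be continued to
  \<open>u\<close>, whose past runs entirely inside \<open>K\<close>. A block far to the left then
  belongs to both classes.\<close>

lemma minimal_component_if_past_determined:
  assumes K: "K \<in> classes" "u \<in> K" and u: "past_determined u"
  shows "minimal_component A X (component K)"
  unfolding minimal_component_def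
proof (intro conjI ballI impI)
  show "component K \<in> irreducible_components A X" using K by (simp add: irreducible_components_eq)
  fix D assume D: "D \<in> irreducible_components A X" "component_le A X D (component K)"
  then obtain L where L: "L \<in> classes" "D = component L" by (auto simp: irreducible_components_eq)
  obtain y M M' where y: "y \<in> X" "\<And>k. k \<le> M \<Longrightarrow> block N y k \<in> L" "\<And>k. k \<ge> M' \<Longrightarrow> block N y k \<in> K"
    using component_leE D(2) L K(1) by metis
  obtain z a where z: "z \<in> component K" "block N z a = u" using periodic_point[OF K] by metis
  then have zX: "z \<in> X" by (simp add: component_def)
  have "reach (block N y M') (block N z a)" using class_reach[OF K(1)] y(3) z(2) K(2) by simp
  then obtain w d where w: "w \<in> X" "d > 0"
      "\<And>l. l \<le> M' \<Longrightarrow> block N w l = block N y l"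
      "\<And>l. l \<ge> M' + d \<Longrightarrow> block N w l = block N z (l - (M' + d) + a)"
    using connect[OF y(1) zX] by blast
  have "block N w (M' + d) = u" using w(4)[of "M' + d"] z(2) by simp
  then have past: "block N w (M' + d - t) = block N z (a - t)" if "t \<ge> 0" for t
    using u w(1) zX z(2) that unfolding past_determined_def by blast
  \<comment> \<open>The minimum serves both bounds: below \<open>M\<close> the block of
    \<open>y\<close> is in \<open>L\<close>, below \<open>M'\<close> it is also a block of
    \<open>w\<close>.\<close>
  have "block N y (min M M') = block N z (a - (M' + d - min M M'))"
    using past[of "M' + d - min M M'"] w(2) w(3)[of "min M M'"] by simp
  then have "block N y (min M M') \<in> K" using z(1) by (simp add: component_def)
  then show "D = component K" using y(2)[of "min M M'"] class_eqI[OF L(1) K(1)] L(2) by auto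
qed

lemma maximal_component_if_future_determined:
  assumes K: "K \<in> classes" "u \<in> K" and u: "future_determined u"
  shows "maximal_component A X (component K)"
  unfolding maximal_component_def
proof (intro conjI ballI impI)
  show "component K \<in> irreducible_components A X" using K by (simp add: irreducible_components_eq)
  fix D assume D: "D \<in> irreducible_components A X" "component_le A X (component K) D"
  then obtain L where L: "L \<in> classes" "D = component L" by (auto simp: irreducible_components_eq)
  obtain y M M' where y: "y \<in> X" "\<And>k. k \<le> M \<Longrightarrow> block N y k \<in> K" "\<And>k. k \<ge> M' \<Longrightarrow> block N y k \<in> L"
    using component_leE D(2) L K(1) by metis
  obtain z a where z: "z \<in> component K" "block N z a = u" using periodic_point[OF K] by metis
  then have zX: "z \<in> X" by (simp add: component_def)
  have "reach (block N z a) (block N y M)" using class_reach[OF K(1)] y(2) z(2) K(2) by simp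
  then obtain w d where w: "w \<in> X" "d > 0"
      "\<And>l. l \<le> a \<Longrightarrow> block N w l = block N z l"
      "\<And>l. l \<ge> a + d \<Longrightarrow> block N w l = block N y (l - (a + d) + M)"
    using connect[OF zX y(1)] by blast
  have "block N w a = u" using w(3) z(2) by simp
  then have future: "block N w (a + t) = block N z (a + t)" if "t \<ge> 0" for t
    using u w(1) zX z(2) that unfolding future_determined_def by blast
  define t where "t = d + (max M M' - M)"
  have "block N y (max M M') = block N z (a + t)"
    using future[of t] w(2) w(4)[of "a + t"] by (simp add: t_def)
  then have "block N y (max M M') \<in> K" using z(1) by (simp add: component_def)
  then show "D = component K" using y(3)[of "max M M'"] class_eqI[OF L(1) K(1)] L(2) by auto
qed

text \<open>The class \<open>L\<close> of the far past of \<open>y\<close> yields a component below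
  \<open>component K\<close>; minimality gives \<open>L = K\<close>, and blocks between blocks of
  \<open>K\<close> stay in \<open>K\<close>.\<close>

lemma minimal_component_past_in_class:
  assumes "minimal_component A X (component K)" "K \<in> classes" "y \<in> X" "block N y i \<in> K" "k \<le> i"
  shows "block N y k \<in> K"
proof -
  obtain L M where L: "L \<in> classes" "\<And>k. k \<le> M \<Longrightarrow> block N y k \<in> L"
    using past_class[OF assms(3)] by blast
  have "component_le A X (component L) (component K)"
    by (rule component_leI[OF L(1) assms(2,3) L(2)[of "min M i"] assms(4)]) auto
  then have "component L = component K"
    using assms(1) L(1) by (auto simp: minimal_component_def irreducible_components_eq)
  then have "L = K" using component_inj L(1) assms(2) by blast
  then have "block N y (min M k) \<in> K" using L(2) by simp
  from blocks_in_class_between[OF assms(2,3) this assms(4) _ assms(5)] show ?thesis by simp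
qed

lemma maximal_component_future_in_class:
  assumes "maximal_component A X (component K)" "K \<in> classes" "y \<in> X" "block N y i \<in> K" "i \<le> k"
  shows "block N y k \<in> K"
proof -
  obtain L M where L: "L \<in> classes" "\<And>k. k \<ge> M \<Longrightarrow> block N y k \<in> L"
    using future_class[OF assms(3)] by blast
  have "component_le A X (component K) (component L)"
    by (rule component_leI[OF assms(2) L(1) assms(3,4) L(2)[of "max M i"]]) auto
  then have "component L = component K"
    using assms(1) L(1) by (auto simp: maximal_component_def irreducible_components_eq)
  then have "L = K" using component_inj L(1) assms(2) by blast
  then have "block N y (max M k) \<in> K" using L(2) by simp
  from blocks_in_class_between[OF assms(2,3,4) this assms(5)] show ?thesis by simp
qed

section \<open>Isolated configurations\<close>

text \<open>Replacing the past of \<open>x\<close> before \<open>i\<close> by that of a translate of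
  \<open>y\<close> leaves the window \<open>[-m, m]\<close> untouched, so isolation forces the
  result to be \<open>x\<close>.\<close>

lemma past_determined_if_isolated:
  assumes x: "x \<in> X" and m: "\<And>y. y \<in> X \<Longrightarrow> (\<forall>k. \<bar>k\<bar> \<le> m \<longrightarrow> y k = x k) \<Longrightarrow> y = x" and i: "i \<le> - m"
  shows "past_determined (block N x i)"
proof -
  have "block N y (j - t) = block N x (i - t)"
    if y: "y \<in> X" "block N y j = block N x i" and t: "t \<ge> 0" for y j t
  proof -
    let ?y = "\<lambda>k. y (k + (j - i))"
    have e: "block N ?y i = block N x i" using y(2) unfolding block_shift by simp
    have "splice_at ?y i x i \<in> X" using shift_in_X[OF y(1)] x e by (rule splice_in_X)
    moreover have "\<forall>k. \<bar>k\<bar> \<le> m \<longrightarrow> splice_at ?y i x i k = x k" using i by (auto simp: splice_at_def)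
    ultimately have "splice_at ?y i x i = x" by (rule m)
    then have "block N x (i - t) = block N ?y (i - t)"
      using block_splice_left[OF e, of "i - t"] t by simp
    then show ?thesis unfolding block_shift by simp
  qed
  then show ?thesis unfolding past_determined_def by metis
qed

text \<open>Here the replacement starts at \<open>i\<close> itself, so \<open>i\<close> must lie
  strictly beyond \<open>m\<close>.\<close>

lemma future_determined_if_isolated:
  assumes x: "x \<in> X" and m: "\<And>y. y \<in> X \<Longrightarrow> (\<forall>k. \<bar>k\<bar> \<le> m \<longrightarrow> y k = x k) \<Longrightarrow> y = x" and i: "i > m"
  shows "future_determined (block N x i)"
proof -
  have "block N y (j + t) = block N x (i + t)"
    if y: "y \<in> X" "block N y j = block N x i" and t: "t \<ge> 0" for y j t
  proof -
    have "splice_at x i y j \<in> X" using x y by (intro splice_in_X) auto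
    moreover have "\<forall>k. \<bar>k\<bar> \<le> m \<longrightarrow> splice_at x i y j k = x k" using i by (auto simp: splice_at_def)
    ultimately have "splice_at x i y j = x" by (rule m)
    then show ?thesis
      using block_splice_right[of i "i + t" N x y j] t by (simp add: add.commute)
  qed
  then show ?thesis unfolding future_determined_def by metis
qed

theorem isolated_iff:
  assumes x: "x \<in> X"
  shows "openin (subtopology (full_shift A) X) {x} \<longleftrightarrow>
    finite (C_alpha A X x) \<and> finite (C_omega A X x) \<and>
    minimal_component A X (C_alpha A X x) \<and> maximal_component A X (C_omega A X x)"
    (is "?L \<longleftrightarrow> ?R")
proof -
  obtain K M where K: "K \<in> classes" "\<And>k. k \<le> M \<Longrightarrow> block N x k \<in> K"
    using past_class[OF x] by blast
  obtain K' M' where K': "K' \<in> classes" "\<And>k. k \<ge> M' \<Longrightarrow> block N x k \<in> K'"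
    using future_class[OF x] by blast
  have alpha: "C_alpha A X x = component K" using C_alpha_eq[OF x K] .
  have omega: "C_omega A X x = component K'" using C_omega_eq[OF x K'] .
  have iso: "?L \<longleftrightarrow> (\<exists>m. \<forall>y\<in>X. (\<forall>k. \<bar>k\<bar> \<le> m \<longrightarrow> y k = x k) \<longrightarrow> y = x)"
    unfolding openin_subtopology_full_shift_iff[OF X_subset] using x by auto
  show ?thesis
  proof
    assume ?L
    then obtain m where m: "\<And>y. y \<in> X \<Longrightarrow> (\<forall>k. \<bar>k\<bar> \<le> m \<longrightarrow> y k = x k) \<Longrightarrow> y = x"
      unfolding iso by blast
    \<comment> \<open>The position is far enough left for the block to be in \<open>K\<close> and
      for isolation to determine its past; the next line does the same on the right.\<close>
    have past: "past_determined (block N x (min M (- m)))"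
      by (rule past_determined_if_isolated[OF x m]) auto
    have future: "future_determined (block N x (max M' (m + 1)))"
      by (rule future_determined_if_isolated[OF x m]) auto
    have inK: "block N x (min M (- m)) \<in> K" "block N x (max M' (m + 1)) \<in> K'"
      using K(2) K'(2) by auto
    show ?R
      unfolding alpha omega
      using finite_component_if_past_determined[OF K(1) inK(1) past]
        finite_component_if_future_determined[OF K'(1) inK(2) future]
        minimal_component_if_past_determined[OF K(1) inK(1) past]
        maximal_component_if_future_determined[OF K'(1) inK(2) future]
      by blast
  next
    assume R: ?R
    then have fin: "finite (component K)" "finite (component K')"
      and mini: "minimal_component A X (component K)"
      and maxi: "maximal_component A X (component K')"
      unfolding alpha omega by auto
    \<comment> \<open>This window contains the blocks at \<open>M\<close> and \<open>M'\<close> and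
      everything between them, so \<open>y\<close> can differ from \<open>x\<close> only in the two
      tails, which finiteness and extremality control.\<close>
    define m where "m = \<bar>M\<bar> + \<bar>M'\<bar> + N"
    have "y = x" if y: "y \<in> X" "\<forall>k. \<bar>k\<bar> \<le> m \<longrightarrow> y k = x k" for y
    proof
      fix k
      have eM: "block N y M = block N x M" "block N y M' = block N x M'"
        using blocks_eq_if_agree[OF y(2)] by (simp_all add: m_def)
      have yK: "block N y M \<in> K" "block N y M' \<in> K'" using eM K(2) K'(2) by auto
      consider "k \<le> M" | "k \<ge> M'" | "M < k" "k < M'" by linarith
      then show "y k = x k"
      proof cases
        case 1
        then have "block N y k = block N x k"
          using finite_component_past_unique[OF K(1) fin(1) y(1) x eM(1)] K(2)
            minimal_component_past_in_class[OF mini K(1) y(1) yK(1)] by blast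
        then show ?thesis by (rule block_eq_imp_eq)
      next
        case 2
        then have "block N y k = block N x k"
          using finite_component_future_unique[OF K'(1) fin(2) y(1) x eM(2)] K'(2)
            maximal_component_future_in_class[OF maxi K'(1) y(1) yK(2)] by blast
        then show ?thesis by (rule block_eq_imp_eq)
      next
        case 3
        then have "\<bar>k\<bar> \<le> m" using N_pos by (simp add: m_def)
        then show ?thesis using y(2) by blast
      qed
    qed
    then show ?L unfolding iso by blast
  qed
qed

end

section \<open>Passage from finite type to blocks\<close>

text \<open>Blocks are one letter longer than the defining words, so that they are non-empty even
  for words of length 0.\<close>

lemma block_determined_if_finite_type:
  assumes "finite A" "subshift_of_finite_type A X"
  shows "\<exists>N. block_determined A X N"
proof -
  obtain n S where X: "X = {x \<in> topspace (full_shift A).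
      \<forall>i. map (\<lambda>k. x (i + int k)) [1..<n + 1] \<in> S}"
    using assms(2) by (auto simp: subshift_of_finite_type_def)
  have "block_determined A X (int n + 1)"
  proof
    show "finite A" by fact
    show "int n + 1 > 0" by simp
    show "x k \<in> A" if "x \<in> X" for x k using that by (simp add: X topspace_full_shift)
    fix x assume blocks: "\<And>i. \<exists>y\<in>X. \<exists>j. block (int n + 1) x i = block (int n + 1) y j"
    have "x i \<in> A \<and> map (\<lambda>k. x (i + int k)) [1..<n + 1] \<in> S" for i
    proof -
      obtain y j where y: "y \<in> X" "block (int n + 1) x i = block (int n + 1) y j"
        using blocks by blast
      \<comment> \<open>Offsets \<open>1\<close> to \<open>n\<close> of the window give the defining
        word, while offset \<open>0\<close> gives \<open>x i \<in> A\<close> independently of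
        \<open>n\<close>.\<close>
      have "map (\<lambda>k. x (i + int k)) [1..<n + 1] = map (\<lambda>k. y (j + int k)) [1..<n + 1]"
        using block_eqD[OF y(2)] by (intro map_cong) auto
      moreover have "x i = y j" using block_eqD[OF y(2), of 0] by simp
      moreover have "y j \<in> A" "map (\<lambda>k. y (j + int k)) [1..<n + 1] \<in> S"
        using y(1) unfolding X topspace_full_shift by blast+
      ultimately show ?thesis by metis
    qed
    then show "x \<in> X" by (simp add: X topspace_full_shift)
  qed
  then show ?thesis by blast
qed

theorem proposition3p11:
  fixes A :: "'a set" and X :: "(int \<Rightarrow> 'a) set" and x :: "int \<Rightarrow> 'a"
  assumes "finite A"
    and "subshift_of_finite_type A X"
    and "x \<in> X"
  shows "openin (subtopology (full_shift A) X) {x} \<longleftrightarrow>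
    finite (C_alpha A X x) \<and> finite (C_omega A X x) \<and>
    minimal_component A X (C_alpha A X x) \<and> maximal_component A X (C_omega A X x)"
proof -
  obtain N where "block_determined A X N"
    using block_determined_if_finite_type[OF assms(1,2)] by blast
  then show ?thesis using assms(3) by (rule block_determined.isolated_iff)
qed

end
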